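(* For every integer $n\ge 4$ and every integer $i$ with $\lceil\frac{n}{3}\rceil\le i\le n$, the number $|\mathcal{C}_n^i|$ equals the coefficient of $u^nv^i$ in the power series expansion of \[f(u,v)=\frac{u^4v^2\,(6+4v+v^2+5u+4uv+uv^2+3u^2+3u^2v+u^2v^2)}{1-uv-u^2v-u^3v}.\]
   Context: For an integer $m\ge 3$, $C_m$ denotes the cycle with vertex set $[m]=\{1,2,\dots,m\}$ and edge set $\{\{1,2\},\{2,3\},\dots,\{m-1,m\},\{m,1\}\}$. A set $S$ of vertices of a graph $G$ is a dominating set if every vertex not in $S$ is adjacent to at least one vertex of $S$. $\mathcal{C}_m^j$ denotes the family of dominating sets of $C_m$ of cardinality $j$. $\lceil x\rceil$ is the least integer $\ge x$. *)

theory Defs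
  imports Complex_Main "HOL-Computational_Algebra.Formal_Power_Series"
begin

definition cycle_verts :: "nat \<Rightarrow> nat set" where
  "cycle_verts m = {1..m}"

definition cycle_edges :: "nat \<Rightarrow> nat set set" where
  "cycle_edges m = {{k, k + 1} | k. 1 \<le> k \<and> k < m} \<union> {{m, 1}}"

definition dominating_set :: "'a set \<Rightarrow> 'a set set \<Rightarrow> 'a set \<Rightarrow> bool" where
  "dominating_set V E S \<longleftrightarrow> S \<subseteq> V \<and> (\<forall>x\<in>V - S. \<exists>y\<in>S. {x, y} \<in> E)"

definition cycle_dom_sets :: "nat \<Rightarrow> nat \<Rightarrow> nat set set" where
  "cycle_dom_sets m j = {S. dominating_set (cycle_verts m) (cycle_edges m) S \<and> card S = j}"

text \<open>
  Bivariate formal power series are represented by \<^typ>\<open>rat fps fps\<close>: the outer variable is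
  \<open>u\<close>, and the coefficients are power series in \<open>v\<close>, so the coefficient of
  \<open>u\<^sup>n v\<^sup>i\<close> in \<open>F\<close> is \<open>fps_nth (fps_nth F n) i\<close>.
\<close>

type_synonym bifps = "rat fps fps"

definition bi_u :: bifps where "bi_u = fps_X"

definition bi_v :: bifps where "bi_v = fps_const fps_X"

definition bi_coeff :: "bifps \<Rightarrow> nat \<Rightarrow> nat \<Rightarrow> rat" where
  "bi_coeff F n i = fps_nth (fps_nth F n) i"

definition cycle_gf :: bifps where
  "cycle_gf = (let u = bi_u; v = bi_v in
     (u^4 * v^2 * (6 + 4*v + v^2 + 5*u + 4*u*v + u*v^2 + 3*u^2 + 3*u^2*v + u^2*v^2))
       / (1 - u*v - u^2*v - u^3*v))"

text \<open>
  Since \<^typ>\<open>rat fps\<close> is not a field, division in \<^typ>\<open>rat fps fps\<close> is not exact in general.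
  Here the denominator is a unit, so \<^const>\<open>cycle_gf\<close> is the genuine quotient:
\<close>

lemma cycle_gf_mult_denominator:
  "cycle_gf * (1 - bi_u * bi_v - bi_u^2 * bi_v - bi_u^3 * bi_v) =
     bi_u^4 * bi_v^2 * (6 + 4*bi_v + bi_v^2 + 5*bi_u + 4*bi_u*bi_v + bi_u*bi_v^2
       + 3*bi_u^2 + 3*bi_u^2*bi_v + bi_u^2*bi_v^2)"
proof -
  define d where "d = 1 - bi_u * bi_v - bi_u^2 * bi_v - bi_u^3 * bi_v"
  have d0: "fps_nth d 0 = 1"
    by (simp add: d_def bi_u_def)
  then have "subdegree d = 0"
    by (intro subdegree_eq_0) simp
  then have div: "a / d = a * inverse d" for a
    by (rule fps_divide_unit')
  have i1: "inverse (1 :: rat fps) = 1"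
    by (simp add: fps_inverse_one')
  have inv: "inverse d * d = 1"
    using fps_right_inverse[of d 1] d0 i1 by (simp add: fps_inverse_def[of d] mult.commute)
  show ?thesis
    unfolding cycle_gf_def Let_def d_def[symmetric] div mult.assoc inv by simp
qed

end

theory Submission
  imports Defs
begin

text \<open>
  For \<open>n \<ge> 3\<close> a set of vertices dominates the cycle iff it meets every three cyclically consecutive
  vertices. Cutting the cycle between \<open>n\<close> and \<open>1\<close>, such a set has smallest element \<open>1 + a\<close> and
  largest element \<open>n - b\<close> with \<open>a + b \<le> 2\<close>, and in between it meets every three consecutive
  integers. Deleting the largest element of a set of the latter kind moves its maximum down by
  1, 2 or 3, so the enumerating polynomials \<open>q\<^sub>d\<close> of these sets, indexed by the
  difference \<open>d\<close> of the end points, satisfy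
  \<open>q\<^sub>d = v (q\<^bsub>d-1\<^esub> + q\<^bsub>d-2\<^esub> + q\<^bsub>d-3\<^esub>)\<close>. Hence the polynomials
  \<open>q\<^bsub>n-1\<^esub> + 2 q\<^bsub>n-2\<^esub> + 3 q\<^bsub>n-3\<^esub>\<close> counting the dominating sets of the cycle obey the
  recurrence encoded by the denominator, and the numerator records the initial values
  \<open>n = 4, 5, 6\<close>.
\<close>

section \<open>Sets of integers with bounded gaps and fixed end points\<close>

definition gap_sets :: "nat \<Rightarrow> nat \<Rightarrow> nat \<Rightarrow> nat set set" where
  "gap_sets a b j = {S. S \<subseteq> {a..b} \<and> a \<in> S \<and> b \<in> S \<and>
     (\<forall>x. a \<le> x \<and> x + 2 \<le> b \<longrightarrow> x \<in> S \<or> x + 1 \<in> S \<or> x + 2 \<in> S) \<and> card S = j}"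

text \<open>The equations for 1 and 2 are the general recurrence with the terms of negative index
  dropped; \<open>gap_poly 0\<close> counts the single set whose end points coincide.\<close>

fun gap_poly :: "nat \<Rightarrow> rat fps" where
  "gap_poly 0 = fps_X"
| "gap_poly (Suc 0) = fps_X * gap_poly 0"
| "gap_poly (Suc (Suc 0)) = fps_X * (gap_poly (Suc 0) + gap_poly 0)"
| "gap_poly (Suc (Suc (Suc d))) = fps_X * (gap_poly (Suc (Suc d)) + gap_poly (Suc d) + gap_poly d)"

lemma finite_gap_sets [simp]: "finite (gap_sets a b j)"
  by (rule finite_subset[of _ "Pow {a..b}"]) (auto simp: gap_sets_def)

lemma gap_sets_empty: "b < a \<Longrightarrow> gap_sets a b j = {}"
  by (auto simp: gap_sets_def)

text \<open>Every member has \<open>a\<close> as its minimum and \<open>b\<close> as its maximum, so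
  it determines both end points.\<close>

lemma gap_sets_disjoint: "a \<noteq> a' \<or> b \<noteq> b' \<Longrightarrow> gap_sets a b j \<inter> gap_sets a' b' j' = {}"
  by (auto simp: gap_sets_def subset_iff) (meson order.antisym)+

lemma gap_sets_0: "gap_sets a b 0 = {}"
  by (auto simp: gap_sets_def dest: finite_subset)

lemma gap_sets_self: "gap_sets a a j = (if j = 1 then {{a}} else {})"
  by (auto simp: gap_sets_def dest: subset_singletonD)

text \<open>A window of three that ends after \<open>c\<close> but not after \<open>b\<close>, where
  \<open>b \<le> c + 3\<close>, either contains \<open>c\<close> or ends at
  \<open>b\<close>.\<close>

lemma insert_gap_sets:
  assumes "T \<in> gap_sets a c j" and "c < b" and "b \<le> c + 3"
  shows "insert b T \<in> gap_sets a b (Suc j)"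
proof -
  have T: "T \<subseteq> {a..c}" "a \<in> T" "c \<in> T" "card T = j"
    and gap: "\<And>x. a \<le> x \<Longrightarrow> x + 2 \<le> c \<Longrightarrow> x \<in> T \<or> x + 1 \<in> T \<or> x + 2 \<in> T"
    using assms(1) by (auto simp: gap_sets_def)
  have "finite T" "b \<notin> T"
    using T(1) assms(2) by (auto intro: finite_subset)
  moreover have "x \<in> insert b T \<or> x + 1 \<in> insert b T \<or> x + 2 \<in> insert b T"
    if "a \<le> x" "x + 2 \<le> b" for x
  proof (cases "x + 2 \<le> c")
    case True
    then show ?thesis using gap that by blast
  next
    case False
    then have "x = c \<or> x + 1 = c \<or> x + 2 = b" using that assms(2,3) by linarith
    then show ?thesis using T(3) by auto
  qed
  ultimately show ?thesis
    using T assms(2) by (auto simp: gap_sets_def)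
qed

text \<open>A window inside \<open>{a..c}\<close> cannot contain \<open>b\<close>, so it is still
  met once \<open>b\<close> is removed.\<close>

lemma remove_max_gap_sets:
  assumes "S \<in> gap_sets a b (Suc j)" and "c \<in> S" and "c < b" and "S - {b} \<subseteq> {..c}"
  shows "S - {b} \<in> gap_sets a c j"
proof -
  have S: "S \<subseteq> {a..b}" "a \<in> S" "b \<in> S" "card S = Suc j"
    and gap: "\<And>x. a \<le> x \<Longrightarrow> x + 2 \<le> b \<Longrightarrow> x \<in> S \<or> x + 1 \<in> S \<or> x + 2 \<in> S"
    using assms(1) by (auto simp: gap_sets_def)
  have "x \<in> S - {b} \<or> x + 1 \<in> S - {b} \<or> x + 2 \<in> S - {b}" if "a \<le> x" "x + 2 \<le> c" for x
    using gap[of x] that assms(3) by auto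
  moreover have "a \<le> c" "S - {b} \<subseteq> {a..c}"
    using S(1) assms(2,4) by (auto simp: subset_iff)
  ultimately show ?thesis
    using S assms(2,3) by (auto simp: gap_sets_def)
qed

text \<open>The three images sort the sets by their second largest element.\<close>

lemma gap_sets_step:
  assumes "1 \<le> a" and "a < b"
  shows "gap_sets a b (Suc j) = insert b ` gap_sets a (b - 1) j \<union>
    insert b ` gap_sets a (b - 2) j \<union> insert b ` gap_sets a (b - 3) j" (is "?L = ?R")
proof
  show "?R \<subseteq> ?L"
  proof -
    have "insert b T \<in> ?L" if "T \<in> gap_sets a (b - k) j" "k \<in> {1,2,3}" for T k
      using that assms by (intro insert_gap_sets[OF that(1)]) auto
    then show ?thesis by blast
  qed
  show "?L \<subseteq> ?R"
  proof
    fix S assume S: "S \<in> ?L"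
    then have sub: "S \<subseteq> {a..b}" and ends: "a \<in> S" "b \<in> S"
      and gap: "\<And>x. a \<le> x \<Longrightarrow> x + 2 \<le> b \<Longrightarrow> x \<in> S \<or> x + 1 \<in> S \<or> x + 2 \<in> S"
      by (auto simp: gap_sets_def)
    have "\<exists>k\<in>{1,2,3}. S - {b} \<in> gap_sets a (b - k) j"
    proof -
      consider "b - 1 \<in> S" | "b - 1 \<notin> S" "b - 2 \<in> S" | "b - 1 \<notin> S" "b - 2 \<notin> S" by blast
      then show ?thesis
      proof cases
        case 1
        have "S - {b} \<subseteq> {..b - 1}" using sub by force
        then show ?thesis using remove_max_gap_sets[OF S 1] assms by auto
      next
        case 2
        have "x \<le> b - 2" if "x \<in> S - {b}" for x
        proof -
          have "x \<le> b" "x \<noteq> b" "x \<noteq> b - 1" using that sub 2 by auto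
          then show ?thesis by linarith
        qed
        then show ?thesis using remove_max_gap_sets[OF S 2(2)] assms by auto
      next
        case 3
        \<comment> \<open>Since \<open>a\<close> belongs to \<open>S\<close>, it must lie below
          \<open>b - 2\<close>; hence the window from \<open>b - 3\<close> to \<open>b - 1\<close>
          lies within the end points and can only be met at \<open>b - 3\<close>.\<close>
        have "a \<noteq> b - 1" "a \<noteq> b - 2" using 3 ends(1) by auto
        then have le: "a \<le> b - 3" "3 \<le> b"
          using assms by linarith+
        have "b - 3 + 1 = b - 2" "b - 3 + 2 = b - 1" using le by auto
        then have mem: "b - 3 \<in> S" using gap[of "b - 3"] 3 le by auto
        have "x \<le> b - 3" if "x \<in> S - {b}" for x
        proof -
          have "x \<le> b" "x \<noteq> b" "x \<noteq> b - 1" "x \<noteq> b - 2" using that sub 3 by auto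
          then show ?thesis by linarith
        qed
        then show ?thesis using remove_max_gap_sets[OF S mem] assms by auto
      qed
    qed
    moreover have "S = insert b (S - {b})" using ends by blast
    ultimately show "S \<in> ?R" by blast
  qed
qed

lemma card_gap_sets_step:
  assumes "1 \<le> a" and "a < b"
  shows "card (gap_sets a b (Suc j)) =
    card (gap_sets a (b - 1) j) + card (gap_sets a (b - 2) j) + card (gap_sets a (b - 3) j)"
proof -
  have notin: "b \<notin> T" if "T \<in> gap_sets a (b - k) j" "1 \<le> k" for T k
    using that assms by (auto simp: gap_sets_def)
  have card: "card (insert b ` gap_sets a (b - k) j) = card (gap_sets a (b - k) j)"
    if "1 \<le> k" for k
    using notin[OF _ that] by (intro card_image inj_onI) (metis insert_ident)
  have disj: "insert b ` gap_sets a (b - k) j \<inter> insert b ` gap_sets a (b - l) j = {}"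
    if "1 \<le> k" "k < l" for k l
  \<comment> \<open>Truncated differences can coincide only at 0, which is below \<open>a\<close>,
    and then no sets exist. Otherwise the maxima differ.\<close>
  proof (cases "b - k < a")
    case True
    then show ?thesis by (simp add: gap_sets_empty)
  next
    case False
    then have "gap_sets a (b - k) j \<inter> gap_sets a (b - l) j = {}"
      using that assms by (intro gap_sets_disjoint) linarith
    moreover have "T = T'"
      if "T \<in> gap_sets a (b - k) j" "T' \<in> gap_sets a (b - l) j" "insert b T = insert b T'" for T T'
      using that \<open>1 \<le> k\<close> \<open>k < l\<close> notin by (metis insert_ident le_trans less_imp_le)
    ultimately show ?thesis by blast
  qed
  show ?thesis
    unfolding gap_sets_step[OF assms]
    using disj[of 1 2] disj[of 1 3] disj[of 2 3] card[of 1] card[of 2] card[of 3]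
    by (simp add: card_Un_disjoint Int_Un_distrib2)
qed

text \<open>The induction mirrors \<open>gap_poly\<close>. In the recursive cases
  \<open>j = 0\<close> stands apart: no member is empty, and the polynomial has the factor
  \<open>fps_X\<close>. For \<open>Suc i\<close> that factor shifts the coefficient index, matching
  the removed maximum.\<close>

lemma card_gap_sets:
  assumes "1 \<le> a"
  shows "of_nat (card (gap_sets a (a + d) j)) = fps_nth (gap_poly d) j"
proof (induction d arbitrary: j rule: gap_poly.induct)
  case 1
  then show ?case by (auto simp: gap_sets_self)
next
  case 2
  then show ?case
    using assms by (cases j) (auto simp: gap_sets_0 card_gap_sets_step gap_sets_self gap_sets_empty)
next
  case 3
  show ?case
  proof (cases j)
    case 0
    then show ?thesis by (simp add: gap_sets_0)
  next
    case (Suc i)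
    then show ?thesis
      using assms 3[of i] by (simp add: card_gap_sets_step gap_sets_empty)
  qed
next
  case (4 d)
  show ?case
  proof (cases j)
    case 0
    then show ?thesis by (simp add: gap_sets_0)
  next
    case (Suc i)
    then show ?thesis
      using assms 4[of i] by (simp add: card_gap_sets_step)
  qed
qed

section \<open>Dominating sets of the cycle\<close>

lemma dominating_set_cycle_iff:
  assumes "3 \<le> n"
  shows "dominating_set (cycle_verts n) (cycle_edges n) S \<longleftrightarrow>
    S \<subseteq> {1..n} \<and> (\<forall>x. 1 \<le> x \<and> x + 2 \<le> n \<longrightarrow> x \<in> S \<or> x + 1 \<in> S \<or> x + 2 \<in> S) \<and>
    (n \<in> S \<or> 1 \<in> S \<or> 2 \<in> S) \<and> (n - 1 \<in> S \<or> n \<in> S \<or> 1 \<in> S)" (is "_ \<longleftrightarrow> ?R")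
proof -
  have edge: "{x, y} \<in> cycle_edges n \<longleftrightarrow>
    (1 \<le> x \<and> x < n \<and> y = x + 1) \<or> (1 \<le> y \<and> y < n \<and> x = y + 1) \<or> (x = n \<and> y = 1) \<or> (x = 1 \<and> y = n)"
    for x y
    unfolding cycle_edges_def by (auto simp: doubleton_eq_iff)
  show ?thesis
  proof
    assume dom: "dominating_set (cycle_verts n) (cycle_edges n) S"
    then have sub: "S \<subseteq> {1..n}"
      by (simp add: dominating_set_def cycle_verts_def)
    have D: "x \<in> S \<or> (\<exists>y\<in>S. {x, y} \<in> cycle_edges n)" if "1 \<le> x" "x \<le> n" for x
      using dom that by (auto simp: dominating_set_def cycle_verts_def)
    \<comment> \<open>The window starting at \<open>x\<close> is the closed neighbourhood of
      \<open>x + 1\<close>; the closed neighbourhoods of 1 and \<open>n\<close> wrap around and give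
      the last two conditions.\<close>
    have "x \<in> S \<or> x + 1 \<in> S \<or> x + 2 \<in> S" if "1 \<le> x" "x + 2 \<le> n" for x
      using D[of "x + 1"] that by (auto simp: edge)
    moreover have "n \<in> S \<or> 1 \<in> S \<or> 2 \<in> S"
      using D[of 1] assms by (auto simp: edge numeral_2_eq_2)
    moreover have "n - 1 \<in> S \<or> n \<in> S \<or> 1 \<in> S"
      using D[of n] assms by (auto simp: edge)
    ultimately show ?R using sub by blast
  next
    assume R: ?R
    have "\<exists>y\<in>S. {x, y} \<in> cycle_edges n" if x: "1 \<le> x" "x \<le> n" "x \<notin> S" for x
    proof -
      consider "x = 1" | "x = n" | "1 < x" "x < n" using x by linarith
      then show ?thesis
      proof cases
        case 1
        then have "n \<in> S \<or> 2 \<in> S" using R x by auto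
        moreover have "{x, n} \<in> cycle_edges n" "{x, 2} \<in> cycle_edges n"
          using 1 assms by (simp_all add: edge)
        ultimately show ?thesis by blast
      next
        case 2
        then have "n - 1 \<in> S \<or> 1 \<in> S" using R x by auto
        moreover have "{x, n - 1} \<in> cycle_edges n" "{x, 1} \<in> cycle_edges n"
          using 2 assms by (auto simp: edge)
        ultimately show ?thesis by blast
      next
        case 3
        then have eq: "x - 1 + 1 = x" "x - 1 + 2 = x + 1" by auto
        have "1 \<le> x - 1" "x - 1 + 2 \<le> n" using 3 by auto
        then have "x - 1 \<in> S \<or> x - 1 + 1 \<in> S \<or> x - 1 + 2 \<in> S" using R by blast
        then have "x - 1 \<in> S \<or> x + 1 \<in> S" using eq x by auto
        moreover have "{x, x - 1} \<in> cycle_edges n" "{x, x + 1} \<in> cycle_edges n"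
          using 3 by (auto simp: edge)
        ultimately show ?thesis by blast
      qed
    qed
    then show "dominating_set (cycle_verts n) (cycle_edges n) S"
      using R by (auto simp: dominating_set_def cycle_verts_def)
  qed
qed

text \<open>The six families are the pairs of end points with (a - 1) + (n - b) \<le> 2: at most two
  consecutive vertices are missed across the cut.\<close>

lemma cycle_dom_sets_eq:
  assumes "4 \<le> n"
  shows "cycle_dom_sets n j = gap_sets 1 n j \<union> (gap_sets 1 (n - 1) j \<union> (gap_sets 2 n j \<union>
    (gap_sets 1 (n - 2) j \<union> (gap_sets 2 (n - 1) j \<union> gap_sets 3 n j))))" (is "?L = ?R")
proof
  obtain m where n: "n = m + 4" using assms by (metis add.commute le_Suc_ex)
  have shift: "n - 1 = m + 3" "n - 2 = m + 2" by (auto simp: n)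
  show "?L \<subseteq> ?R"
  proof
    fix S assume "S \<in> ?L"
    then have sub: "S \<subseteq> {1..m + 4}" and card: "card S = j"
      and gap: "\<And>x. 1 \<le> x \<Longrightarrow> x + 2 \<le> m + 4 \<Longrightarrow> x \<in> S \<or> x + 1 \<in> S \<or> x + 2 \<in> S"
      and wrap: "m + 4 \<in> S \<or> 1 \<in> S \<or> 2 \<in> S" "m + 3 \<in> S \<or> m + 4 \<in> S \<or> 1 \<in> S"
      using dominating_set_cycle_iff[of n S] by (auto simp: cycle_dom_sets_def n add.commute)
    have lo: "1 \<in> S \<or> 2 \<in> S \<or> 3 \<in> S" using gap[of 1] by (simp add: eval_nat_numeral)
    have hi: "m + 2 \<in> S \<or> m + 3 \<in> S \<or> m + 4 \<in> S" using gap[of "m + 2"] by (simp add: eval_nat_numeral)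
    have I: "S \<in> gap_sets a b j"
      if "a \<in> S" "b \<in> S" "1 \<le> a" "b \<le> m + 4" "\<And>x. x \<in> S \<Longrightarrow> a \<le> x" "\<And>x. x \<in> S \<Longrightarrow> x \<le> b" for a b
      using that gap card by (auto simp: gap_sets_def)
    have bnd: "1 \<le> x" "x \<le> m + 4" if "x \<in> S" for x using sub that by auto
    have lo2: "2 \<le> x" if "1 \<notin> S" "x \<in> S" for x
      using bnd[of x] that by (cases "x = 1") auto
    have lo3: "3 \<le> x" if "1 \<notin> S" "2 \<notin> S" "x \<in> S" for x
      using lo2[of x] that by (cases "x = 2") auto
    have hi3: "x \<le> m + 3" if "m + 4 \<notin> S" "x \<in> S" for x
      using bnd[of x] that by (cases "x = m + 4") auto
    have hi2: "x \<le> m + 2" if "m + 4 \<notin> S" "m + 3 \<notin> S" "x \<in> S" for x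
      using hi3[of x] that by (cases "x = m + 3") auto
    \<comment> \<open>By \<open>wrap\<close>, minimum 3 forces maximum \<open>m + 4\<close>, and
      maximum \<open>m + 2\<close> forces minimum 1, which leaves six pairs of extremes.\<close>
    consider "1 \<in> S" "m + 4 \<in> S" | "1 \<in> S" "m + 4 \<notin> S" "m + 3 \<in> S"
      | "1 \<in> S" "m + 4 \<notin> S" "m + 3 \<notin> S" "m + 2 \<in> S" | "1 \<notin> S" "2 \<in> S" "m + 4 \<in> S"
      | "1 \<notin> S" "2 \<in> S" "m + 4 \<notin> S" "m + 3 \<in> S" | "1 \<notin> S" "2 \<notin> S" "3 \<in> S" "m + 4 \<in> S"
      using lo hi wrap by blast
    then show "S \<in> ?R"
    proof cases
      case 1
      then have "S \<in> gap_sets 1 (m + 4) j" using bnd by (intro I) auto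
      then show ?thesis unfolding shift n by blast
    next
      case 2
      then have "S \<in> gap_sets 1 (m + 3) j" using bnd hi3 by (intro I) auto
      then show ?thesis unfolding shift by blast
    next
      case 3
      then have "S \<in> gap_sets 1 (m + 2) j" using bnd hi2 by (intro I) auto
      then show ?thesis unfolding shift by blast
    next
      case 4
      then have "S \<in> gap_sets 2 (m + 4) j" using bnd lo2 by (intro I) auto
      then show ?thesis unfolding shift n by blast
    next
      case 5
      then have "S \<in> gap_sets 2 (m + 3) j" using hi3 lo2 by (intro I) auto
      then show ?thesis unfolding shift by blast
    next
      case 6
      then have "S \<in> gap_sets 3 (m + 4) j" using bnd lo3 by (intro I) auto
      then show ?thesis unfolding shift n by blast
    qed
  qed
  \<comment> \<open>The last hypothesis is (a - 1) + (n - b) \<le> 2, written without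
    subtraction.\<close>
  have "gap_sets a b j \<subseteq> ?L" if ab: "1 \<le> a" "b \<le> n" "a + n \<le> b + 3" for a b
  proof
    fix S assume "S \<in> gap_sets a b j"
    then have S: "S \<subseteq> {a..b}" "a \<in> S" "b \<in> S" "card S = j"
      and gap: "\<And>x. a \<le> x \<Longrightarrow> x + 2 \<le> b \<Longrightarrow> x \<in> S \<or> x + 1 \<in> S \<or> x + 2 \<in> S"
      by (auto simp: gap_sets_def)
    have "x \<in> S \<or> x + 1 \<in> S \<or> x + 2 \<in> S" if "1 \<le> x" "x + 2 \<le> n" for x
    proof (cases "a \<le> x \<and> x + 2 \<le> b")
      case True
      then show ?thesis using gap by blast
    next
      case False
      \<comment> \<open>Here a \<le> 3 and b \<ge> n - 2, so a window inside \<open>{1..n}\<close>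
        that leaves \<open>{a..b}\<close> contains one of the end points.\<close>
      then have "a = x + 1 \<or> a = x + 2 \<or> b = x \<or> b = x + 1"
        using ab that by linarith
      then show ?thesis using S by auto
    qed
    moreover have "n \<in> S \<or> 1 \<in> S \<or> 2 \<in> S"
    proof -
      have "b = n \<or> a = 1 \<or> a = 2" using ab by linarith
      then show ?thesis using S by auto
    qed
    moreover have "n - 1 \<in> S \<or> n \<in> S \<or> 1 \<in> S"
    proof -
      have "b = n - 1 \<or> b = n \<or> a = 1" using ab by linarith
      then show ?thesis using S by auto
    qed
    moreover have "S \<subseteq> {1..n}" using S(1) ab by auto
    ultimately show "S \<in> ?L"
      using S(4) assms by (simp add: cycle_dom_sets_def dominating_set_cycle_iff)
  qed
  then show "?R \<subseteq> ?L" using assms by (intro Un_least) auto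
qed

text \<open>The coefficients 1, 2, 3 are the numbers of admissible pairs of end points at distance
  \<open>n - 1\<close>, \<open>n - 2\<close>, \<open>n - 3\<close>.\<close>

definition cycle_poly :: "nat \<Rightarrow> rat fps" where
  "cycle_poly n = gap_poly (n - 1) + 2 * gap_poly (n - 2) + 3 * gap_poly (n - 3)"

lemma card_cycle_dom_sets:
  assumes "4 \<le> n"
  shows "of_nat (card (cycle_dom_sets n j)) = fps_nth (cycle_poly n) j"
proof -
  have "card (cycle_dom_sets n j) = card (gap_sets 1 n j) + (card (gap_sets 1 (n - 1) j) +
    (card (gap_sets 2 n j) + (card (gap_sets 1 (n - 2) j) +
    (card (gap_sets 2 (n - 1) j) + card (gap_sets 3 n j)))))"
    unfolding cycle_dom_sets_eq[OF assms] using assms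
    by (simp add: card_Un_disjoint Int_Un_distrib gap_sets_disjoint)
  moreover have "of_nat (card (gap_sets a b j)) = fps_nth (gap_poly (b - a)) j"
    if "1 \<le> a" "a \<le> b" for a b
    using card_gap_sets[OF that(1), of "b - a" j] that(2) by simp
  ultimately show ?thesis
    using assms
    by (simp add: cycle_poly_def numeral_fps_const eval_nat_numeral)
qed

section \<open>Coefficients of the generating function\<close>

lemma cycle_poly_rec:
  "cycle_poly (n + 7) = fps_X * (cycle_poly (n + 6) + cycle_poly (n + 5) + cycle_poly (n + 4))"
  by (simp add: cycle_poly_def eval_nat_numeral algebra_simps)

text \<open>This compares the coefficients of u^n after clearing the denominator. Here
  \<open>fps_X\<close> is the inner variable v, and the tests on \<open>n\<close> replace
  coefficients of negative index by zero.\<close>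

lemma cycle_gf_nth_rec:
  "fps_nth cycle_gf n =
    fps_X * ((if n < 1 then 0 else fps_nth cycle_gf (n - 1)) +
      (if n < 2 then 0 else fps_nth cycle_gf (n - 2)) +
      (if n < 3 then 0 else fps_nth cycle_gf (n - 3))) +
    (if n = 4 then fps_X^2 * (6 + 4 * fps_X + fps_X^2)
     else if n = 5 then fps_X^2 * (5 + 4 * fps_X + fps_X^2)
     else if n = 6 then fps_X^2 * (3 + 3 * fps_X + fps_X^2) else 0)"
proof -
  let ?c = "\<lambda>p. fps_const p :: bifps"
  let ?X = "fps_X :: rat fps"
  have const: "?c (?X^2 * (numeral k + numeral l * ?X + ?X^2)) =
      bi_v^2 * (numeral k + numeral l * bi_v + bi_v^2)" for k l
    by (simp add: bi_v_def numeral_fps_const flip: fps_const_mult fps_const_add fps_const_power)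
  \<comment> \<open>The product with the denominator is split off so that the numerator can replace
    it. The power \<open>fps_X^1\<close> is kept so that \<open>fps_X_power_mult_nth\<close> applies
    to every summand.\<close>
  have "cycle_gf = fps_X^1 * (?c ?X * cycle_gf) + fps_X^2 * (?c ?X * cycle_gf)
      + fps_X^3 * (?c ?X * cycle_gf)
      + cycle_gf * (1 - bi_u * bi_v - bi_u^2 * bi_v - bi_u^3 * bi_v)"
    by (simp add: bi_u_def bi_v_def algebra_simps)
  moreover have "cycle_gf * (1 - bi_u * bi_v - bi_u^2 * bi_v - bi_u^3 * bi_v) =
      fps_X^4 * ?c (?X^2 * (6 + 4 * ?X + ?X^2)) + fps_X^5 * ?c (?X^2 * (5 + 4 * ?X + ?X^2))
      + fps_X^6 * ?c (?X^2 * (3 + 3 * ?X + ?X^2))"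
    unfolding cycle_gf_mult_denominator const unfolding bi_u_def by algebra
  ultimately have "fps_nth cycle_gf n =
      fps_nth (fps_X^1 * (?c ?X * cycle_gf) + fps_X^2 * (?c ?X * cycle_gf)
      + fps_X^3 * (?c ?X * cycle_gf) + (fps_X^4 * ?c (?X^2 * (6 + 4 * ?X + ?X^2))
      + fps_X^5 * ?c (?X^2 * (5 + 4 * ?X + ?X^2))
      + fps_X^6 * ?c (?X^2 * (3 + 3 * ?X + ?X^2)))) n"
    by (metis (no_types))
  then show ?thesis
    unfolding fps_add_nth fps_X_power_mult_nth
    by (auto simp: distrib_left)
qed

lemma cycle_gf_nth:
  assumes "4 \<le> n"
  shows "fps_nth cycle_gf n = cycle_poly n"
  using assms
proof (induction n rule: less_induct)
  case (less n)
  \<comment> \<open>For n = 4, 5, 6 the recurrence reaches below 4, where the series vanishes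
    although \<open>cycle_poly\<close> need not; the numerator terms make up the difference.\<close>
  have z: "fps_nth cycle_gf 0 = 0" "fps_nth cycle_gf 1 = 0" "fps_nth cycle_gf 2 = 0"
    "fps_nth cycle_gf 3 = 0"
    using cycle_gf_nth_rec[of 0] cycle_gf_nth_rec[of 1] cycle_gf_nth_rec[of 2]
      cycle_gf_nth_rec[of 3] by simp_all
  \<comment> \<open>From 7 on, all three predecessors are at least 4, so the induction hypothesis
    covers them and the numerator adds nothing.\<close>
  consider "n = 4" | "n = 5" | "n = 6" | m where "n = m + 7"
    using less.prems nat_le_iff_add[of 7 n] by (force simp: add.commute)
  then show ?case
  proof cases
    case 1
    then show ?thesis
      using z by (subst cycle_gf_nth_rec)
        (simp add: cycle_poly_def eval_nat_numeral algebra_simps)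
  next
    case 2
    then show ?thesis
      using z less.IH[of 4] by (subst cycle_gf_nth_rec)
        (simp add: cycle_poly_def eval_nat_numeral algebra_simps)
  next
    case 3
    then show ?thesis
      using z less.IH[of 4] less.IH[of 5] by (subst cycle_gf_nth_rec)
        (simp add: cycle_poly_def eval_nat_numeral algebra_simps)
  next
    case (4 m)
    then show ?thesis
      using less.IH[of "m + 4"] less.IH[of "m + 5"] less.IH[of "m + 6"]
      by (subst cycle_gf_nth_rec) (simp add: cycle_poly_rec add.commute)
  qed
qed

theorem theorem3:
  fixes n i :: nat
  assumes "n \<ge> 4" and "\<lceil>real n / 3\<rceil> \<le> int i" and "i \<le> n"
  shows "of_nat (card (cycle_dom_sets n i)) = bi_coeff cycle_gf n i"
  using assms(1) by (simp add: bi_coeff_def cycle_gf_nth card_cycle_dom_sets)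

end
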